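(* Consider a network of $N$ parallel roads with mixed human-driven and autonomous traffic, flow demand $(\bar{x},\bar{y})$ and altruism profile $\varphi$, such that the set BANE of Best-case Altruistic Nash Equilibria is nonempty. Then there exist a longest equilibrium road $m^*_{\mathrm{EQ}}$ and a longest used road $m^*_{\mathrm{ALL}}$ with $m^*_{\mathrm{EQ}}\le m^*_{\mathrm{ALL}}$ such that all routings in BANE have the following properties: (1) roads with index less than $m^*_{\mathrm{EQ}}$ are congested; (2) roads with index greater than $m^*_{\mathrm{EQ}}$ are in free-flow; (3) roads with index greater than $m^*_{\mathrm{EQ}}$ and less than $m^*_{\mathrm{ALL}}$ have maximum flow.
   Context: Network model. There are $N$ parallel roads (same origin and destination), indexed by $[N]=\{1,\dots,N\}$. Road $i$ has length $d_i>0$, free-flow speed $v^f_i>0$, maximum density $\rho^{\max}_i$, and nominal headways $\bar{h}_i\le h_i$ for autonomous and human-driven vehicles respectively; all vehicles have length $L>0$. Let $x_i,y_i\ge 0$ be the human-driven and autonomous flow on road $i$. The critical density is $$\rho^{\mathrm{crit}}_i(x_i,y_i)=\left(\frac{y_i}{x_i+y_i}\bar{h}_i+\frac{x_i}{x_i+y_i}h_i+L\right)^{-1},$$ with $\rho^{\mathrm{crit}}_i<\rho^{\max}_i$ always, and the maximum flow is $z^{\max}_i(x_i,y_i)=v^f_i\,\rho^{\mathrm{crit}}_i(x_i,y_i)$; road $i$ has maximum flow if $x_i+y_i=z^{\max}_i(x_i,y_i)$. The state $s_i\in\{0,1\}$ says whether road $i$ is in free-flow ($s_i=0$) or congested ($s_i=1$).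 The latency is $$\ell_i(x_i,y_i,s_i)=\begin{cases} d_i/v^f_i, & s_i=0,\\ d_i\left(\dfrac{\rho^{\max}_i}{x_i+y_i}+\dfrac{\rho^{\mathrm{crit}}_i(x_i,y_i)-\rho^{\max}_i}{z^{\max}_i(x_i,y_i)}\right), & s_i=1.\end{cases}$$ The free-flow latency is $a_i=d_i/v^f_i$; no two roads have equal free-flow latencies and roads are ordered so that $a_1<a_2<\dots<a_N$. A road with zero flow is in free-flow (latency $a_i$), and a road carrying exactly its maximum flow (where both formulas give $a_i$) is regarded as in free-flow. Routings. The demand $(\bar{x},\bar{y})$, $\bar{x},\bar{y}\ge 0$, is inelastic. A feasible routing of the demand is a triple $(\boldsymbol{x},\boldsymbol{y},\boldsymbol{s})\in\mathbb{R}^N_{\ge0}\times\mathbb{R}^N_{\ge0}\times\{0,1\}^N$ with $\sum_i x_i=\bar{x}$, $\sum_i y_i=\bar{y}$ and $x_i+y_i\le z^{\max}_i(x_i,y_i)$ on every road (trivially satisfied if $x_i+y_i=0$). Its total latency is $C(\boldsymbol{x},\boldsymbol{y},\boldsymbol{s})=\sum_{i\in[N]}(x_i+y_i)\ell_i(x_i,y_i,s_i)$. Altruism. Human drivers are selfish. The altruism profile of autonomous users is a nondecreasing function $\varphi:\mathbb{R}_{\ge0}\to[0,1]$: a volume $\varphi(\kappa)\bar{y}$ of autonomous flow rejects any route whose delay is $\kappa$ times the minimum available route delay. Altruism profiles have finitely many altruism levels, i.e. there are $0\le\kappa_0<\kappa_1<\dots<\kappa_{k-1}$ and $0\le\varphi_0\le\dots\le\varphi_{k-2}\le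 1$ such that $\varphi(\kappa)=0$ for $0\le\kappa\le\kappa_0$, $\varphi(\kappa)=\varphi_j$ for $\kappa_j<\kappa\le\kappa_{j+1}$, and $\varphi(\kappa)=1$ for $\kappa>\kappa_{k-1}$. For an equilibrium latency $\hat{\ell}_0$, the set $\mathrm{ANE}(\bar{x},\bar{y},\hat{\ell}_0,\varphi)$ of Altruistic Nash Equilibria consists of the feasible routings such that (i) all roads with human-driven flow have latency $\hat{\ell}_0$, and $\hat{\ell}_0\le\ell_i(x_i,y_i,s_i)$ for all $i\in[N]$; and (ii) for every $\ell\ge0$, a volume of at least $\varphi(\ell/\hat{\ell}_0)\,\bar{y}$ of autonomous traffic experiences a delay less than or equal to $\ell$. BANE is the set of routings that minimize $C$ among all Altruistic Nash Equilibria (over all $\hat{\ell}_0$) for the given $\bar{x},\bar{y},\varphi$. For a routing in ANE, the longest equilibrium road is the road with maximum free-flow latency whose delay equals the delay $\hat{\ell}_0$ experienced by selfish users; the longest used road is the road with maximum free-flow latency that carries positive flow of any type. Roads are identified with their indices.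
   Formalization: The longest equilibrium and longest used roads are taken separately for each routing in BANE, since one common pair for all routings can fail to exist; total demand is assumed positive, since with zero demand no road is used. *)

theory Defs
  imports Complex_Main "HOL-Library.FuncSet"
begin

record network =
  num_roads :: nat
  road_length :: "nat \<Rightarrow> real"
  ff_speed :: "nat \<Rightarrow> real"
  max_density :: "nat \<Rightarrow> real"
  aut_headway :: "nat \<Rightarrow> real"
  hum_headway :: "nat \<Rightarrow> real"
  veh_length :: real

definition roads :: "network \<Rightarrow> nat set" where
  "roads G = {1..num_roads G}"

definition ff_latency :: "network \<Rightarrow> nat \<Rightarrow> real" where
  "ff_latency G i = road_length G i / ff_speed G i"

text \<open>In all functions below, \<open>x\<close> is human-driven and \<open>y\<close> is autonomous flow.\<close>

definition crit_density :: "network \<Rightarrow> nat \<Rightarrow> real \<Rightarrow> real \<Rightarrow> real" where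
  "crit_density G i x y =
     inverse (y / (x + y) * aut_headway G i + x / (x + y) * hum_headway G i + veh_length G)"

definition max_flow :: "network \<Rightarrow> nat \<Rightarrow> real \<Rightarrow> real \<Rightarrow> real" where
  "max_flow G i x y = ff_speed G i * crit_density G i x y"

definition has_max_flow :: "network \<Rightarrow> nat \<Rightarrow> real \<Rightarrow> real \<Rightarrow> bool" where
  "has_max_flow G i x y \<longleftrightarrow> x + y = max_flow G i x y"

text \<open>The critical density is only meaningful for nonzero flow (the autonomous share
  is \<open>0 / 0\<close> otherwise), so the bound by the maximum density is imposed only there.\<close>

definition valid_network :: "network \<Rightarrow> bool" where
  "valid_network G \<longleftrightarrow>
     0 < veh_length G \<and>
     (\<forall>i\<in>roads G. 0 < road_length G i \<and> 0 < ff_speed G i \<and> 0 < max_density G i \<and>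
        0 \<le> aut_headway G i \<and> aut_headway G i \<le> hum_headway G i \<and>
        (\<forall>x\<ge>0. \<forall>y\<ge>0. 0 < x + y \<longrightarrow> crit_density G i x y < max_density G i)) \<and>
     strict_mono_on (roads G) (ff_latency G)"

text \<open>The state of a road is 0 (free-flow) or 1 (congested).\<close>

definition latency :: "network \<Rightarrow> nat \<Rightarrow> real \<Rightarrow> real \<Rightarrow> nat \<Rightarrow> real" where
  "latency G i x y s =
     (if s = 0 then ff_latency G i
      else road_length G i *
        (max_density G i / (x + y) +
         (crit_density G i x y - max_density G i) / max_flow G i x y))"

type_synonym routing = "(nat \<Rightarrow> real) \<times> (nat \<Rightarrow> real) \<times> (nat \<Rightarrow> nat)"

text \<open>The last conjunct is the convention that a road with zero flow, or with exactly its
  maximum flow, is in free-flow.\<close>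

definition feasible_routings :: "network \<Rightarrow> real \<Rightarrow> real \<Rightarrow> routing set" where
  "feasible_routings G xbar ybar =
     {(x, y, s).
        x \<in> roads G \<rightarrow>\<^sub>E {0..} \<and> y \<in> roads G \<rightarrow>\<^sub>E {0..} \<and> s \<in> roads G \<rightarrow>\<^sub>E {0, 1} \<and>
        (\<Sum>i\<in>roads G. x i) = xbar \<and> (\<Sum>i\<in>roads G. y i) = ybar \<and>
        (\<forall>i\<in>roads G. 0 < x i + y i \<longrightarrow> x i + y i \<le> max_flow G i (x i) (y i)) \<and>
        (\<forall>i\<in>roads G. x i + y i = 0 \<or> has_max_flow G i (x i) (y i) \<longrightarrow> s i = 0)}"

definition total_latency :: "network \<Rightarrow> routing \<Rightarrow> real" where
  "total_latency G = (\<lambda>(x, y, s). \<Sum>i\<in>roads G. (x i + y i) * latency G i (x i) (y i) (s i))"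

text \<open>Only the values of \<open>\<phi>\<close> on nonnegative reals matter.\<close>

definition altruism_profile :: "(real \<Rightarrow> real) \<Rightarrow> bool" where
  "altruism_profile \<phi> \<longleftrightarrow>
     mono_on {0..} \<phi> \<and> \<phi> \<in> {0..} \<rightarrow> {0..1} \<and>
     (\<exists>(k::nat) (\<kappa>::nat \<Rightarrow> real) (v::nat \<Rightarrow> real).
        1 \<le> k \<and> 0 \<le> \<kappa> 0 \<and> strict_mono_on {..<k} \<kappa> \<and>
        mono_on {..<k-1} v \<and> v \<in> {..<k-1} \<rightarrow> {0..1} \<and>
        (\<forall>t. 0 \<le> t \<and> t \<le> \<kappa> 0 \<longrightarrow> \<phi> t = 0) \<and>
        (\<forall>j<k-1. \<forall>t. \<kappa> j < t \<and> t \<le> \<kappa> (Suc j) \<longrightarrow> \<phi> t = v j) \<and>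
        (\<forall>t. \<kappa> (k - 1) < t \<longrightarrow> \<phi> t = 1))"

text \<open>Equilibrium latencies \<open>l0\<close> are positive, so that the ratio \<open>l / l0\<close> makes sense. This
  only matters without human-driven demand: otherwise \<open>l0\<close> is the latency of some road.\<close>

definition ANE :: "network \<Rightarrow> real \<Rightarrow> real \<Rightarrow> real \<Rightarrow> (real \<Rightarrow> real) \<Rightarrow> routing set" where
  "ANE G xbar ybar l0 \<phi> =
     {(x, y, s). (x, y, s) \<in> feasible_routings G xbar ybar \<and> 0 < l0 \<and>
        (\<forall>i\<in>roads G. 0 < x i \<longrightarrow> latency G i (x i) (y i) (s i) = l0) \<and>
        (\<forall>i\<in>roads G. l0 \<le> latency G i (x i) (y i) (s i)) \<and>
        (\<forall>l\<ge>0. \<phi> (l / l0) * ybar \<le>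
           (\<Sum>i | i \<in> roads G \<and> latency G i (x i) (y i) (s i) \<le> l. y i))}"

definition BANE :: "network \<Rightarrow> real \<Rightarrow> real \<Rightarrow> (real \<Rightarrow> real) \<Rightarrow> routing set" where
  "BANE G xbar ybar \<phi> =
     {r. is_arg_min (total_latency G) (\<lambda>r. \<exists>l0. r \<in> ANE G xbar ybar l0 \<phi>) r}"

definition longest_equilibrium_road :: "network \<Rightarrow> real \<Rightarrow> routing \<Rightarrow> nat \<Rightarrow> bool" where
  "longest_equilibrium_road G l0 = (\<lambda>(x, y, s).
     is_arg_max (ff_latency G) (\<lambda>i. i \<in> roads G \<and> latency G i (x i) (y i) (s i) = l0))"

definition longest_used_road :: "network \<Rightarrow> routing \<Rightarrow> nat \<Rightarrow> bool" where
  "longest_used_road G = (\<lambda>(x, y, s).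
     is_arg_max (ff_latency G) (\<lambda>i. i \<in> roads G \<and> 0 < x i + y i))"

end

theory Submission imports Defs begin

text \<open>
  The latency formula of a congested road looks nonlinear in the two flows, but it is linear
  in disguise. With the load
  \<open>load G i t x y = (h + L + g) x + (h' + L + g) y\<close>, where \<open>h\<close> and \<open>h'\<close> are the human and
  autonomous headways, \<open>L\<close> is the vehicle length and \<open>g\<close> is a multiple of \<open>t\<close> minus the
  free-flow latency of the road, a congested road has latency \<open>t\<close> exactly if its load at \<open>t\<close>
  equals its free-flow speed, and it can carry the flow at all exactly if the load at the
  free-flow latency is at most the free-flow speed. As the load increases with \<open>t\<close>, lowering
  the latency of a congested road makes room for more flow of either type.

  Let \<open>l0\<close> be the minimum latency of a best-case equilibrium. Roads whose free-flow latency
  is below \<open>l0\<close> are congested, and the claim is that they all have latency exactly \<open>l0\<close>, while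
  all other roads are in free-flow (\<open>BANE_latency\<close>). To see this, put the other roads into
  free-flow and pour their flow into the congested ones until these are filled up to their
  load limit at \<open>l0\<close>. If the supply suffices, the result is an equilibrium for the same \<open>l0\<close>:
  what is taken from the slower roads arrives on roads of minimum latency, and all other
  traffic is delayed no more than before, so the altruism constraints remain valid. Its cost
  does not exceed the old one, and optimality forces every used road to have had the
  claimed latency already.

  If the supply runs out, the whole demand fits on roads of free-flow latency below \<open>l0\<close>
  within their load limits at \<open>l0\<close>. Lowering \<open>l0\<close> a little is not an option then: delays relative
  to the minimum would grow, which can violate the altruism constraints, and the roads not
  needed any more would be empty and too fast. Instead, \<open>equilibrium_below\<close> sweeps the traffic
  from the last road to the earlier ones, again and again, until the last road in use, in
  free-flow, has the same latency as all others in use. Everybody then travels at this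
  latency, which is below \<open>l0\<close>: the altruism constraints hold trivially, and the cost is lower
  than before, a contradiction (\<open>BANE_not_below\<close>).

  The three properties follow. Roads before the longest equilibrium road have free-flow
  latency below \<open>l0\<close> and are congested; roads after it have free-flow latency above \<open>l0\<close> and are
  in free-flow. Among the latter, moving a bit of flow from a longer to a shorter road with
  spare capacity only helps (\<open>BANE_max_flow\<close>). Finally, if the longest equilibrium road lay
  behind all used roads, the whole demand would be carried by roads of free-flow latency
  below \<open>l0\<close>, which \<open>BANE_not_below\<close> excludes once more.
\<close>

section \<open>Flow on a road as a linear load\<close>

text \<open>The numerator of the fraction vanishes at the free-flow latency, where the slot is the
  road space needed by a vehicle at critical density; the longer the travel time, the more of
  the free-flow speed each unit of flow uses up.\<close>

definition slot :: "network \<Rightarrow> nat \<Rightarrow> real \<Rightarrow> real \<Rightarrow> real" where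
  "slot G i t h = h + veh_length G +
     ff_speed G i * (t - ff_latency G i) / (max_density G i * road_length G i)"

definition load :: "network \<Rightarrow> nat \<Rightarrow> real \<Rightarrow> real \<Rightarrow> real \<Rightarrow> real" where
  "load G i t x y = slot G i t (hum_headway G i) * x + slot G i t (aut_headway G i) * y"

lemma valid_road:
  assumes "valid_network G" "i \<in> roads G"
  shows "0 < veh_length G" "0 < road_length G i" "0 < ff_speed G i" "0 < max_density G i"
    "0 \<le> aut_headway G i" "aut_headway G i \<le> hum_headway G i"
  using assms unfolding valid_network_def by auto

lemma ff_latency_pos: "valid_network G \<Longrightarrow> i \<in> roads G \<Longrightarrow> 0 < ff_latency G i"
  by (simp add: ff_latency_def valid_road)

lemma ff_latency_less_iff:
  assumes "valid_network G" "i \<in> roads G" "j \<in> roads G"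
  shows "ff_latency G i < ff_latency G j \<longleftrightarrow> i < j"
  using assms unfolding valid_network_def
  by (metis linorder_less_linear order_less_asym strict_mono_onD)

lemma ff_latency_le_iff:
  assumes "valid_network G" "i \<in> roads G" "j \<in> roads G"
  shows "ff_latency G i \<le> ff_latency G j \<longleftrightarrow> i \<le> j"
  using ff_latency_less_iff[OF assms(1,3,2)] by (simp add: linorder_not_less[symmetric])

lemma load_shift:
  "load G i t x y = load G i u x y +
     ff_speed G i / (max_density G i * road_length G i) * (t - u) * (x + y)"
  by (simp add: load_def slot_def diff_divide_distrib add_divide_distrib algebra_simps)

lemma load_mono:
  assumes "valid_network G" "i \<in> roads G" "0 \<le> x" "0 \<le> y" "t \<le> u"
  shows "load G i t x y \<le> load G i u x y"
  using load_shift[of G i u x y t] valid_road[OF assms(1,2)] assms(3-5) by simp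

lemma load_strict_mono:
  assumes "valid_network G" "i \<in> roads G" "0 < x + y" "t < u"
  shows "load G i t x y < load G i u x y"
  using load_shift[of G i u x y t] valid_road[OF assms(1,2)] assms(3-4) by simp

lemma slot_pos:
  assumes "valid_network G" "i \<in> roads G" "ff_latency G i \<le> t"
  shows "0 < slot G i t (hum_headway G i)" "0 < slot G i t (aut_headway G i)"
proof -
  have "0 \<le> ff_speed G i * (t - ff_latency G i) / (max_density G i * road_length G i)"
    using valid_road[OF assms(1,2)] assms(3) by simp
  then show "0 < slot G i t (hum_headway G i)" "0 < slot G i t (aut_headway G i)"
    using valid_road[OF assms(1,2)] unfolding slot_def by linarith+
qed

text \<open>At the free-flow latency the load is the mean headway plus vehicle length, weighted by
  the shares of the two types, times the total flow.\<close>

lemma max_flow_eq: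
  assumes "valid_network G" "i \<in> roads G" "0 \<le> x" "0 \<le> y" "0 < x + y"
  shows "max_flow G i x y = ff_speed G i * (x + y) / load G i (ff_latency G i) x y"
    and "0 < load G i (ff_latency G i) x y"
proof -
  have s: "0 < slot G i (ff_latency G i) (hum_headway G i)"
    "0 < slot G i (ff_latency G i) (aut_headway G i)"
    using slot_pos[OF assms(1,2)] by auto
  show pos: "0 < load G i (ff_latency G i) x y"
    unfolding load_def using s assms(3-5)
    by (smt (verit) mult_pos_pos mult_nonneg_nonneg)
  have "load G i (ff_latency G i) x y =
      (x + y) * (y / (x + y) * aut_headway G i + x / (x + y) * hum_headway G i + veh_length G)"
  proof -
    have "(x + y) * (y / (x + y) * aut_headway G i + x / (x + y) * hum_headway G i + veh_length G) =
        (x + y) * (y / (x + y)) * aut_headway G i + (x + y) * (x / (x + y)) * hum_headway G i +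
        (x + y) * veh_length G"
      by (simp only: algebra_simps)
    also have "\<dots> = y * aut_headway G i + x * hum_headway G i + (x + y) * veh_length G"
      using assms(5) by simp
    finally show ?thesis unfolding load_def slot_def by (simp add: algebra_simps)
  qed
  then show "max_flow G i x y = ff_speed G i * (x + y) / load G i (ff_latency G i) x y"
    using assms(5) by (simp add: max_flow_def crit_density_def divide_inverse)
qed

lemma le_max_flow_iff:
  assumes "valid_network G" "i \<in> roads G" "0 \<le> x" "0 \<le> y" "0 < x + y"
  shows "x + y \<le> max_flow G i x y \<longleftrightarrow> load G i (ff_latency G i) x y \<le> ff_speed G i"
  unfolding max_flow_eq(1)[OF assms] using max_flow_eq(2)[OF assms] assms(5)
  by (simp add: pos_le_divide_eq mult.commute)

lemma has_max_flow_iff: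
  assumes "valid_network G" "i \<in> roads G" "0 \<le> x" "0 \<le> y" "0 < x + y"
  shows "has_max_flow G i x y \<longleftrightarrow> load G i (ff_latency G i) x y = ff_speed G i"
  unfolding has_max_flow_def max_flow_eq(1)[OF assms]
  using max_flow_eq(2)[OF assms] assms(5) by (auto simp: eq_divide_eq)

text \<open>The latency exceeds the free-flow latency by an amount proportional to the unused speed
  \<open>v - load\<close> per unit of flow. Clearing the denominator turns this into the linear equation
  that all later rerouting arguments rest on.\<close>

lemma congested_latency_eq_iff:
  assumes "valid_network G" "i \<in> roads G" "0 \<le> x" "0 \<le> y" "0 < x + y"
  shows "latency G i x y 1 = t \<longleftrightarrow> load G i t x y = ff_speed G i"
proof -
  let ?v = "ff_speed G i" and ?d = "road_length G i" and ?m = "max_density G i"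
  let ?l = "load G i (ff_latency G i) x y"
  note r = valid_road[OF assms(1,2)] and mf = max_flow_eq[OF assms]
  have crit: "crit_density G i x y = max_flow G i x y / ?v"
    using r by (simp add: max_flow_def)
  have "max_flow G i x y \<noteq> 0" using r(3) mf assms(5) by simp
  then have "latency G i x y 1 = ?d * (?m / (x + y) + 1 / ?v - ?m / max_flow G i x y)"
    by (simp add: latency_def crit diff_divide_distrib)
  also have "?m / max_flow G i x y = ?m * ?l / (?v * (x + y))"
    unfolding mf(1) by simp
  also have "?d * (?m / (x + y) + 1 / ?v - ?m * ?l / (?v * (x + y))) =
      ?d / ?v + ?d * ?m * (?v - ?l) / (?v * (x + y))"
  proof -
    have "?m / (x + y) = ?m * ?v / (?v * (x + y))" using r(3) by simp
    then show ?thesis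
      by (simp add: diff_divide_distrib right_diff_distrib distrib_left ac_simps)
  qed
  finally have lat: "latency G i x y 1 = ff_latency G i + ?d * ?m * (?v - ?l) / (?v * (x + y))"
    by (simp add: ff_latency_def)
  have "latency G i x y 1 = t \<longleftrightarrow> ?d * ?m * (?v - ?l) / (?v * (x + y)) = t - ff_latency G i"
    unfolding lat by linarith
  also have "\<dots> \<longleftrightarrow> ?d * ?m * (?v - ?l) = (t - ff_latency G i) * (?v * (x + y))"
    using r assms(5) by (simp add: divide_eq_eq)
  also have "\<dots> \<longleftrightarrow> ?v - ?l = ?v / (?m * ?d) * (t - ff_latency G i) * (x + y)"
    using r by (auto simp: field_simps)
  also have "\<dots> \<longleftrightarrow> load G i t x y = ?v"
    using load_shift[of G i t x y "ff_latency G i"] by linarith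
  finally show ?thesis .
qed

section \<open>Level routings\<close>

text \<open>Fixing a minimum latency \<open>t\<close> determines the state of every road if the roads too fast in
  free-flow are slowed down to exactly \<open>t\<close> and all others are left in free-flow. Humans use a
  slow road only if its free-flow latency happens to be \<open>t\<close>.\<close>

definition levelled :: "network \<Rightarrow> real \<Rightarrow> (nat \<Rightarrow> real) \<Rightarrow> (nat \<Rightarrow> real) \<Rightarrow> bool" where
  "levelled G t x y \<longleftrightarrow> (\<forall>i\<in>roads G. 0 \<le> x i \<and> 0 \<le> y i \<and>
     (if ff_latency G i < t then load G i t (x i) (y i) = ff_speed G i
      else load G i (ff_latency G i) (x i) (y i) \<le> ff_speed G i \<and>
           (0 < x i \<longrightarrow> ff_latency G i = t)))"

definition level_routing :: "network \<Rightarrow> real \<Rightarrow> (nat \<Rightarrow> real) \<Rightarrow> (nat \<Rightarrow> real) \<Rightarrow> routing" where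
  "level_routing G t x y = (restrict x (roads G), restrict y (roads G),
     \<lambda>i\<in>roads G. if ff_latency G i < t then 1 else 0)"

lemma levelled_congested:
  assumes "valid_network G" "levelled G t x y" "i \<in> roads G" "ff_latency G i < t"
  shows "0 < x i + y i" "\<not> has_max_flow G i (x i) (y i)"
    "load G i (ff_latency G i) (x i) (y i) < ff_speed G i" "latency G i (x i) (y i) 1 = t"
proof -
  have nn: "0 \<le> x i" "0 \<le> y i" and ld: "load G i t (x i) (y i) = ff_speed G i"
    using assms unfolding levelled_def by (auto split: if_splits)
  show pos: "0 < x i + y i"
  proof (rule ccontr)
    assume "\<not> 0 < x i + y i"
    then have "x i = 0" "y i = 0" using nn by auto
    then show False using ld valid_road(3)[OF assms(1,3)] by (simp add: load_def)
  qed
  show lt: "load G i (ff_latency G i) (x i) (y i) < ff_speed G i"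
    using load_strict_mono[OF assms(1,3) pos assms(4)] ld by simp
  show "\<not> has_max_flow G i (x i) (y i)"
    using has_max_flow_iff[OF assms(1,3) nn pos] lt by simp
  show "latency G i (x i) (y i) 1 = t"
    using congested_latency_eq_iff[OF assms(1,3) nn pos] ld by simp
qed

lemma level_routing_latency:
  assumes "valid_network G" "levelled G t x y" "i \<in> roads G"
  shows "latency G i (x i) (y i) (if ff_latency G i < t then 1 else 0) = max t (ff_latency G i)"
  using levelled_congested(4)[OF assms] by (auto simp: latency_def)

lemma level_routing_total_latency:
  assumes "valid_network G" "levelled G t x y"
  shows "total_latency G (level_routing G t x y) =
    (\<Sum>i\<in>roads G. (x i + y i) * max t (ff_latency G i))"
  unfolding total_latency_def level_routing_def
  using level_routing_latency[OF assms] by (auto intro!: sum.cong)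

lemma level_routing_feasible:
  assumes "valid_network G" "levelled G t x y"
  shows "level_routing G t x y \<in> feasible_routings G (sum x (roads G)) (sum y (roads G))"
proof -
  have "x i + y i \<le> max_flow G i (x i) (y i)" if i: "i \<in> roads G" and pos: "0 < x i + y i" for i
  proof -
    have nn: "0 \<le> x i" "0 \<le> y i"
      using assms i unfolding levelled_def by auto
    have "load G i (ff_latency G i) (x i) (y i) \<le> ff_speed G i"
      using assms(2) i levelled_congested(3)[OF assms i] unfolding levelled_def by fastforce
    then show ?thesis using le_max_flow_iff[OF assms(1) i nn pos] by simp
  qed
  moreover have "\<not> ff_latency G i < t"
    if "i \<in> roads G" "x i + y i = 0 \<or> has_max_flow G i (x i) (y i)" for i
    using levelled_congested(1,2)[OF assms that(1)] that(2) by fastforce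
  moreover have "\<forall>i\<in>roads G. 0 \<le> x i \<and> 0 \<le> y i"
    using assms(2) unfolding levelled_def by auto
  ultimately show ?thesis
    unfolding level_routing_def feasible_routings_def by auto
qed

text \<open>On level routings only the volume constraint is left to check, and with the latency of
  road \<open>i\<close> being \<open>max t (ff_latency G i)\<close> it can be read off from the free-flow latencies.\<close>

lemma level_routing_in_ANE:
  assumes "valid_network G" "levelled G t x y" "0 < t"
    and "sum x (roads G) = xbar" "sum y (roads G) = ybar"
    and below: "\<And>l. 0 \<le> l \<Longrightarrow> l < t \<Longrightarrow> \<phi> (l / t) * ybar \<le> 0"
    and above: "\<And>l. t \<le> l \<Longrightarrow>
      \<phi> (l / t) * ybar \<le> (\<Sum>i | i \<in> roads G \<and> ff_latency G i \<le> l. y i)"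
  shows "level_routing G t x y \<in> ANE G xbar ybar t \<phi>"
proof -
  let ?R = "roads G"
  let ?x = "restrict x ?R" and ?y = "restrict y ?R"
  let ?s = "\<lambda>i\<in>?R. if ff_latency G i < t then 1 else 0"
  have lat: "latency G i (?x i) (?y i) (?s i) = max t (ff_latency G i)" if "i \<in> ?R" for i
    using level_routing_latency[OF assms(1,2) that] that by simp
  have hum: "max t (ff_latency G i) = t" if "i \<in> ?R" "0 < ?x i" for i
    using assms(2) that unfolding levelled_def by (auto split: if_splits)
  have vol: "\<phi> (l / t) * ybar \<le> (\<Sum>i | i \<in> ?R \<and> latency G i (?x i) (?y i) (?s i) \<le> l. ?y i)"
    if "0 \<le> l" for l
  proof (cases "l < t")
    case True
    have "0 \<le> (\<Sum>i | i \<in> ?R \<and> latency G i (?x i) (?y i) (?s i) \<le> l. ?y i)"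
      using assms(2) by (intro sum_nonneg) (auto simp: levelled_def)
    then show ?thesis using below[OF that True] by linarith
  next
    case False
    have "{i. i \<in> ?R \<and> latency G i (?x i) (?y i) (?s i) \<le> l} = {i \<in> ?R. ff_latency G i \<le> l}"
      using lat False by (auto simp del: restrict_apply)
    then show ?thesis using above[of l] False by simp
  qed
  show ?thesis
    using level_routing_feasible[OF assms(1,2)] assms(3-5) lat hum vol
    unfolding ANE_def level_routing_def by (auto simp del: restrict_apply)
qed

section \<open>Filling roads\<close>

text \<open>Receivers with linear capacity constraints absorb a pool \<open>(X, Y)\<close> of two kinds of flow one
  after the other, each taking as large a fraction of what is left as it has room for. As both
  kinds are taken in the same proportion, the pool keeps its mixture, and the remainder is
  described by a single factor \<open>c\<close>; whoever supplied the pool can therefore just scale its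
  flow by \<open>c\<close>.\<close>

lemma fill_receivers:
  fixes \<alpha> \<beta> v x y :: "'a \<Rightarrow> real"
  assumes "finite A"
    and "\<And>j. j \<in> A \<Longrightarrow> 0 < \<alpha> j \<and> 0 < \<beta> j \<and> \<alpha> j * x j + \<beta> j * y j \<le> v j"
    and "0 \<le> X" "0 \<le> Y"
  shows "\<exists>c x' y'. 0 \<le> c \<and> c \<le> 1 \<and>
    (\<forall>j\<in>A. x j \<le> x' j \<and> y j \<le> y' j \<and> \<alpha> j * x' j + \<beta> j * y' j \<le> v j) \<and>
    sum x' A = sum x A + (1 - c) * X \<and> sum y' A = sum y A + (1 - c) * Y \<and>
    ((\<forall>j\<in>A. \<alpha> j * x' j + \<beta> j * y' j = v j) \<or> c = 0)"
  using assms(1,2)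
proof (induction A rule: finite_induct)
  case empty
  show ?case by (rule exI[of _ 1]) auto
next
  case (insert a A)
  obtain c x' y' where c: "0 \<le> c" "c \<le> 1"
    and le: "\<forall>j\<in>A. x j \<le> x' j \<and> y j \<le> y' j \<and> \<alpha> j * x' j + \<beta> j * y' j \<le> v j"
    and sums: "sum x' A = sum x A + (1 - c) * X" "sum y' A = sum y A + (1 - c) * Y"
    and dich: "(\<forall>j\<in>A. \<alpha> j * x' j + \<beta> j * y' j = v j) \<or> c = 0"
    using insert.IH insert.prems by auto
  define w where "w = c * (\<alpha> a * X + \<beta> a * Y)"
  define u where "u = v a - (\<alpha> a * x a + \<beta> a * y a)"
  have a: "0 < \<alpha> a" "0 < \<beta> a" and u: "0 \<le> u"
    using insert.prems unfolding u_def by fastforce+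
  have w: "0 \<le> w" unfolding w_def using a c assms(3,4) by simp
  \<comment> \<open>\<open>w\<close> is the load that the remaining pool would put on \<open>a\<close>, and \<open>u\<close> is the room on \<open>a\<close>.\<close>
  define \<theta> where "\<theta> = (if w \<le> u then 1 else u / w)"
  have \<theta>: "0 \<le> \<theta>" "\<theta> \<le> 1" "\<theta> * w \<le> u"
    and sat: "\<theta> * w = u \<or> \<theta> = 1"
    using u w unfolding \<theta>_def by auto
  define x'' where "x'' = x'(a := x a + \<theta> * c * X)"
  define y'' where "y'' = y'(a := y a + \<theta> * c * Y)"
  have eqA: "sum x'' A = sum x' A" "sum y'' A = sum y' A"
    using insert.hyps(2) unfolding x''_def y''_def by (auto intro!: sum.cong)
  have la: "\<alpha> a * x'' a + \<beta> a * y'' a = v a - u + \<theta> * w"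
    unfolding x''_def y''_def u_def w_def by (simp add: algebra_simps)
  have stays: "x'' j = x' j" "y'' j = y' j" if "j \<in> A" for j
    using that insert.hyps(2) unfolding x''_def y''_def by auto
  have ga: "x a \<le> x'' a" "y a \<le> y'' a"
    unfolding x''_def y''_def using \<theta>(1) c assms(3,4) by auto
  show ?case
  proof (intro exI conjI)
    show "0 \<le> c * (1 - \<theta>)" using c \<theta> by simp
    show "c * (1 - \<theta>) \<le> 1" using c \<theta> by (simp add: mult_le_one)
    show "\<forall>j\<in>insert a A. x j \<le> x'' j \<and> y j \<le> y'' j \<and> \<alpha> j * x'' j + \<beta> j * y'' j \<le> v j"
      using le ga la \<theta>(3) by (auto simp: stays)
    show "sum x'' (insert a A) = sum x (insert a A) + (1 - c * (1 - \<theta>)) * X"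
      using insert.hyps by (simp add: eqA sums) (simp add: x''_def algebra_simps)
    show "sum y'' (insert a A) = sum y (insert a A) + (1 - c * (1 - \<theta>)) * Y"
      using insert.hyps by (simp add: eqA sums) (simp add: y''_def algebra_simps)
    show "(\<forall>j\<in>insert a A. \<alpha> j * x'' j + \<beta> j * y'' j = v j) \<or> c * (1 - \<theta>) = 0"
      using dich sat la by (auto simp: stays)
  qed
qed

lemma fill_roads:
  assumes "valid_network G" "A \<subseteq> roads G"
    and "\<And>j. j \<in> A \<Longrightarrow> ff_latency G j \<le> t \<and> load G j t (x j) (y j) \<le> ff_speed G j"
    and "0 \<le> X" "0 \<le> Y"
  obtains c x' y' where "0 \<le> c" "c \<le> 1"
    and "\<And>j. j \<in> A \<Longrightarrow> x j \<le> x' j \<and> y j \<le> y' j \<and> load G j t (x' j) (y' j) \<le> ff_speed G j"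
    and "sum x' A = sum x A + (1 - c) * X" and "sum y' A = sum y A + (1 - c) * Y"
    and "(\<forall>j\<in>A. load G j t (x' j) (y' j) = ff_speed G j) \<or> c = 0"
proof -
  have "finite A" using assms(2) by (rule finite_subset) (simp add: roads_def)
  moreover have "0 < slot G j t (hum_headway G j) \<and> 0 < slot G j t (aut_headway G j) \<and>
      slot G j t (hum_headway G j) * x j + slot G j t (aut_headway G j) * y j \<le> ff_speed G j"
    if "j \<in> A" for j
    using slot_pos[OF assms(1), of j t] assms(2) assms(3)[OF that] that by (auto simp: load_def)
  ultimately show ?thesis
    using fill_receivers[of A "\<lambda>j. slot G j t (hum_headway G j)" "\<lambda>j. slot G j t (aut_headway G j)"
        x y "ff_speed G" X Y] assms(4,5) that
    unfolding load_def by metis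
qed

section \<open>Equilibria in which everybody travels at the minimum latency\<close>

text \<open>Traffic that fits on the first roads within their load limits at the free-flow latency of
  the last of them can be rearranged so that, for some road \<open>p\<close> beyond which all roads are empty,
  everybody has the free-flow latency of \<open>p\<close>. Pour the traffic of the last road into the
  earlier ones until they are filled. What remains fits on the last road in free-flow, since
  it is a scaled-down version of what that road carried. If the traffic does not suffice to
  fill the earlier roads, the last road can be dropped: the limits of the others only become
  more generous at the smaller free-flow latency of the road before.\<close>

lemma equilibrium_below:
  assumes "valid_network G" "Suc n \<in> roads G"
    and "\<And>j. j \<in> {1..Suc n} \<Longrightarrow> 0 \<le> x j \<and> 0 \<le> y j \<and>
      load G j (ff_latency G (Suc n)) (x j) (y j) \<le> ff_speed G j"
  shows "\<exists>p x' y'. p \<in> {1..Suc n} \<and> levelled G (ff_latency G p) x' y' \<and>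
    sum x' (roads G) = sum x {1..Suc n} \<and> sum y' (roads G) = sum y {1..Suc n} \<and>
    (\<forall>j\<in>roads G. p < j \<longrightarrow> x' j = 0 \<and> y' j = 0)"
  using assms(2,3)
proof (induction n arbitrary: x y)
  case (0 x y)
  have sub: "{1..Suc 0} \<subseteq> roads G" using 0 by (auto simp: roads_def)
  let ?x = "\<lambda>j. if j = 1 then x 1 else 0" and ?y = "\<lambda>j. if j = 1 then y 1 else 0"
  have "levelled G (ff_latency G 1) ?x ?y"
    unfolding levelled_def
    using 0 ff_latency_less_iff[OF assms(1) _ 0(1)] valid_road(3)[OF assms(1)]
    by (force simp: roads_def load_def)
  moreover have "sum ?x (roads G) = x 1" "sum ?y (roads G) = y 1"
    using sub by (auto simp: roads_def)
  ultimately show ?case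
    by (intro exI[of _ 1] exI[of _ ?x] exI[of _ ?y]) auto
next
  case (Suc n x y)
  let ?q = "Suc (Suc n)" and ?A = "{1..Suc n}"
  let ?t = "ff_latency G ?q"
  have q: "?q \<in> roads G" by fact
  have sub: "?A \<subseteq> roads G" using q by (auto simp: roads_def)
  have below: "ff_latency G j < ?t" if "j \<in> ?A" for j
    using ff_latency_less_iff[OF assms(1) _ q, of j] that sub by auto
  have xq: "0 \<le> x ?q" "0 \<le> y ?q" using Suc.prems(2)[of ?q] by auto
  obtain c x' y' where c: "0 \<le> c" "c \<le> 1"
    and le: "\<And>j. j \<in> ?A \<Longrightarrow>
      x j \<le> x' j \<and> y j \<le> y' j \<and> load G j ?t (x' j) (y' j) \<le> ff_speed G j"
    and sums: "sum x' ?A = sum x ?A + (1 - c) * x ?q" "sum y' ?A = sum y ?A + (1 - c) * y ?q"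
    and dich: "(\<forall>j\<in>?A. load G j ?t (x' j) (y' j) = ff_speed G j) \<or> c = 0"
  proof (rule fill_roads[OF assms(1) sub, of ?t x y "x ?q" "y ?q"])
    fix j assume j: "j \<in> ?A"
    show "ff_latency G j \<le> ?t \<and> load G j ?t (x j) (y j) \<le> ff_speed G j"
      using below[OF j] Suc.prems(2)[of j] j by auto
  qed (use xq in auto)
  have nn: "0 \<le> x' j" "0 \<le> y' j" if "j \<in> ?A" for j
    using le[OF that] Suc.prems(2)[of j] that by force+
  have roads_split: "j \<in> ?A \<or> j = ?q \<or> ?q < j" if "j \<in> roads G" for j
    using that by (auto simp: roads_def)
  show ?case
  proof (cases "\<forall>j\<in>?A. load G j ?t (x' j) (y' j) = ff_speed G j")
    case True
    let ?x = "\<lambda>j. if j \<in> ?A then x' j else if j = ?q then c * x ?q else 0"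
    let ?y = "\<lambda>j. if j \<in> ?A then y' j else if j = ?q then c * y ?q else 0"
    have "load G ?q ?t (c * x ?q) (c * y ?q) = c * load G ?q ?t (x ?q) (y ?q)"
      by (simp add: load_def algebra_simps)
    also have "\<dots> \<le> c * ff_speed G ?q"
      using Suc.prems(2)[of ?q] c by (simp add: mult_left_mono)
    also have "\<dots> \<le> 1 * ff_speed G ?q"
      using c valid_road(3)[OF assms(1) q] by (intro mult_right_mono) auto
    finally have lq: "load G ?q ?t (c * x ?q) (c * y ?q) \<le> ff_speed G ?q" by simp
    have "levelled G ?t ?x ?y"
      unfolding levelled_def
    proof
      fix i assume i: "i \<in> roads G"
      consider "i \<in> ?A" | "i = ?q" | "i \<notin> ?A" "?q < i" "ff_latency G ?q < ff_latency G i"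
        using roads_split[OF i] ff_latency_less_iff[OF assms(1) q i] by fastforce
      then show "0 \<le> ?x i \<and> 0 \<le> ?y i \<and>
        (if ff_latency G i < ?t then load G i ?t (?x i) (?y i) = ff_speed G i
         else load G i (ff_latency G i) (?x i) (?y i) \<le> ff_speed G i \<and>
              (0 < ?x i \<longrightarrow> ff_latency G i = ?t))"
      proof cases
        case 1 then show ?thesis using nn below True by auto
      next
        case 2 then show ?thesis using lq xq c by simp
      next
        case 3 then show ?thesis using valid_road(3)[OF assms(1) i] by (simp add: load_def)
      qed
    qed
    moreover have "sum f (roads G) = sum f ?A + f ?q" if "\<And>j. ?q < j \<Longrightarrow> f j = 0"
      for f :: "nat \<Rightarrow> real"
    proof -
      have "sum f (roads G) = sum f {1..?q}"
        using q that by (intro sum.mono_neutral_right) (auto simp: roads_def)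
      then show ?thesis by simp
    qed
    then have "sum ?x (roads G) = sum x' ?A + c * x ?q" "sum ?y (roads G) = sum y' ?A + c * y ?q"
      by simp_all
    ultimately show ?thesis
      using sums by (intro exI[of _ ?q] exI[of _ ?x] exI[of _ ?y]) (auto simp: algebra_simps)
  next
    case False
    then have c0: "c = 0" using dich by blast
    have "\<exists>p x'' y''. p \<in> {1..Suc n} \<and> levelled G (ff_latency G p) x'' y'' \<and>
      sum x'' (roads G) = sum x' ?A \<and> sum y'' (roads G) = sum y' ?A \<and>
      (\<forall>j\<in>roads G. p < j \<longrightarrow> x'' j = 0 \<and> y'' j = 0)"
    proof (rule Suc.IH)
      show top: "Suc n \<in> roads G" using sub by auto
      fix j assume j: "j \<in> {1..Suc n}"
      have "load G j (ff_latency G (Suc n)) (x' j) (y' j) \<le> load G j ?t (x' j) (y' j)"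
        using j sub nn[OF j] below[of "Suc n"] by (intro load_mono[OF assms(1)]) auto
      then show "0 \<le> x' j \<and> 0 \<le> y' j \<and>
          load G j (ff_latency G (Suc n)) (x' j) (y' j) \<le> ff_speed G j"
        using nn[OF j] le[OF j] by linarith
    qed
    then obtain p x'' y'' where p: "p \<in> {1..Suc n}" "levelled G (ff_latency G p) x'' y''"
      "sum x'' (roads G) = sum x' ?A" "sum y'' (roads G) = sum y' ?A"
      "\<forall>j\<in>roads G. p < j \<longrightarrow> x'' j = 0 \<and> y'' j = 0" by blast
    then show ?thesis
      using sums c0 by (intro exI[of _ p] exI[of _ x''] exI[of _ y'']) simp
  qed
qed

text \<open>When all traffic has the minimum latency, the altruism constraints hold for delay ratios
  of at least 1 because all of the autonomous demand meets them; ratios below 1 can only be met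
  if the profile demands nothing there.\<close>

lemma cheaper_equilibrium:
  assumes "valid_network G"
    and lowroads: "\<And>j. j \<in> roads G \<Longrightarrow> ff_latency G j < t \<Longrightarrow>
      0 \<le> x j \<and> 0 \<le> y j \<and> load G j t (x j) (y j) \<le> ff_speed G j"
    and sx: "(\<Sum>j | j \<in> roads G \<and> ff_latency G j < t. x j) = xbar"
    and sy: "(\<Sum>j | j \<in> roads G \<and> ff_latency G j < t. y j) = ybar"
    and "0 < xbar + ybar" "0 \<le> ybar"
    and phi: "\<And>\<kappa>. 0 \<le> \<kappa> \<Longrightarrow> \<phi> \<kappa> \<le> 1"
    and below: "\<And>\<kappa>. 0 \<le> \<kappa> \<Longrightarrow> \<kappa> < 1 \<Longrightarrow> \<phi> \<kappa> * ybar \<le> 0"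
  shows "\<exists>l0 r. r \<in> ANE G xbar ybar l0 \<phi> \<and> total_latency G r < (xbar + ybar) * t"
proof -
  define P where "P = {j \<in> roads G. ff_latency G j < t}"
  have finP: "finite P" by (simp add: P_def roads_def)
  have "P \<noteq> {}"
  proof
    assume "P = {}"
    then have "xbar = 0" "ybar = 0" using sx sy unfolding P_def by (metis sum.empty)+
    then show False using assms(5) by simp
  qed
  define q where "q = Max P"
  have qP: "q \<in> P" using finP \<open>P \<noteq> {}\<close> unfolding q_def by simp
  then have q: "q \<in> roads G" and qt: "ff_latency G q < t" by (auto simp: P_def)
  then obtain n where n: "q = Suc n" by (cases q) (auto simp: roads_def)
  have Peq: "P = {1..q}"
  proof
    show "P \<subseteq> {1..q}"
      using finP by (auto simp: q_def P_def roads_def intro!: Max_ge)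
    show "{1..q} \<subseteq> P"
    proof
      fix j assume j: "j \<in> {1..q}"
      then have jR: "j \<in> roads G" using q by (auto simp: roads_def)
      then have "ff_latency G j \<le> ff_latency G q"
        using j ff_latency_le_iff[OF assms(1) _ q] by auto
      then show "j \<in> P" using jR qt by (simp add: P_def)
    qed
  qed
  have "\<exists>p x' y'. p \<in> {1..Suc n} \<and> levelled G (ff_latency G p) x' y' \<and>
    sum x' (roads G) = sum x {1..Suc n} \<and> sum y' (roads G) = sum y {1..Suc n} \<and>
    (\<forall>j\<in>roads G. p < j \<longrightarrow> x' j = 0 \<and> y' j = 0)"
  proof (rule equilibrium_below[OF assms(1)])
    show "Suc n \<in> roads G" using q n by simp
    fix j assume "j \<in> {1..Suc n}"
    then have "j \<in> P" unfolding Peq n .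
    then have j: "j \<in> roads G" "ff_latency G j < t" by (auto simp: P_def)
    have nn: "0 \<le> x j" "0 \<le> y j" using lowroads[OF j] by auto
    have "load G j (ff_latency G (Suc n)) (x j) (y j) \<le> load G j t (x j) (y j)"
      using qt n by (intro load_mono[OF assms(1) j(1) nn]) simp
    then show "0 \<le> x j \<and> 0 \<le> y j \<and>
        load G j (ff_latency G (Suc n)) (x j) (y j) \<le> ff_speed G j"
      using lowroads[OF j] by linarith
  qed
  then obtain p x' y' where p: "p \<in> P" and lev: "levelled G (ff_latency G p) x' y'"
    and sums: "sum x' (roads G) = xbar" "sum y' (roads G) = ybar"
    and zero: "\<And>j. j \<in> roads G \<Longrightarrow> p < j \<Longrightarrow> x' j = 0 \<and> y' j = 0"
    using sx sy Peq n unfolding P_def by auto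
  have pR: "p \<in> roads G" and pt: "ff_latency G p < t" using p by (auto simp: P_def)
  let ?a = "ff_latency G p"
  have a: "0 < ?a" using ff_latency_pos[OF assms(1) pR] .
  have "level_routing G ?a x' y' \<in> ANE G xbar ybar ?a \<phi>"
  proof (rule level_routing_in_ANE[OF assms(1) lev a sums])
    fix l :: real assume "0 \<le> l" "l < ?a"
    then show "\<phi> (l / ?a) * ybar \<le> 0" using a by (intro below) auto
  next
    fix l :: real assume l: "?a \<le> l"
    have "\<phi> (l / ?a) * ybar \<le> 1 * ybar"
      using l a assms(6) by (intro mult_right_mono phi) auto
    also have "\<dots> = (\<Sum>i | i \<in> roads G \<and> ff_latency G i \<le> l. y' i)"
    proof -
      have "y' i = 0" if i: "i \<in> roads G" "\<not> ff_latency G i \<le> l" for i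
        using ff_latency_less_iff[OF assms(1) pR i(1)] zero[OF i(1)] i(2) l by force
      then show ?thesis
        unfolding sums(2)[symmetric]
        by simp (intro sum.mono_neutral_right, auto simp: roads_def)
    qed
    finally show "\<phi> (l / ?a) * ybar \<le> (\<Sum>i | i \<in> roads G \<and> ff_latency G i \<le> l. y' i)" .
  qed
  moreover have "total_latency G (level_routing G ?a x' y') < (xbar + ybar) * t"
  proof -
    have "(x' i + y' i) * max ?a (ff_latency G i) = (x' i + y' i) * ?a" if i: "i \<in> roads G" for i
      using zero[OF i] ff_latency_le_iff[OF assms(1) i pR] by (cases "p < i") (auto simp: max_def)
    then have "total_latency G (level_routing G ?a x' y') = (\<Sum>i\<in>roads G. (x' i + y' i) * ?a)"
      unfolding level_routing_total_latency[OF assms(1) lev] by (rule sum.cong[OF refl])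
    also have "\<dots> = (xbar + ybar) * ?a"
      by (simp add: sum_distrib_right[symmetric] sum.distrib sums)
    also have "\<dots> < (xbar + ybar) * t"
      using pt assms(5) by simp
    finally show ?thesis .
  qed
  ultimately show ?thesis by blast
qed

section \<open>Altruistic Nash equilibria and their optima\<close>

lemma ANE_D:
  assumes "(x, y, s) \<in> ANE G xbar ybar l0 \<phi>"
  shows "0 < l0" "(\<Sum>i\<in>roads G. x i) = xbar" "(\<Sum>i\<in>roads G. y i) = ybar"
    "\<And>l. 0 \<le> l \<Longrightarrow>
      \<phi> (l / l0) * ybar \<le> (\<Sum>i | i \<in> roads G \<and> latency G i (x i) (y i) (s i) \<le> l. y i)"
  using assms unfolding ANE_def feasible_routings_def by auto

lemma ANE_road:
  assumes "valid_network G" "(x, y, s) \<in> ANE G xbar ybar l0 \<phi>" "i \<in> roads G"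
  shows "0 \<le> x i" "0 \<le> y i" "s i = 0 \<or> s i = 1"
    "l0 \<le> latency G i (x i) (y i) (s i)"
    "0 < x i \<Longrightarrow> latency G i (x i) (y i) (s i) = l0"
    "s i = 1 \<Longrightarrow> 0 < x i + y i"
    "s i = 1 \<Longrightarrow> ff_latency G i < latency G i (x i) (y i) (s i)"
    "ff_latency G i \<le> latency G i (x i) (y i) (s i)"
    "load G i (latency G i (x i) (y i) (s i)) (x i) (y i) \<le> ff_speed G i"
proof -
  let ?l = "latency G i (x i) (y i) (s i)"
  have feas: "x \<in> roads G \<rightarrow>\<^sub>E {0..}" "y \<in> roads G \<rightarrow>\<^sub>E {0..}" "s \<in> roads G \<rightarrow>\<^sub>E {0, 1}"
    and cap: "0 < x i + y i \<Longrightarrow> x i + y i \<le> max_flow G i (x i) (y i)"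
    and conv: "x i + y i = 0 \<or> has_max_flow G i (x i) (y i) \<Longrightarrow> s i = 0"
    using assms(2,3) unfolding ANE_def feasible_routings_def by auto
  show nn: "0 \<le> x i" "0 \<le> y i" and s: "s i = 0 \<or> s i = 1"
    using PiE_mem[OF feas(1) assms(3)] PiE_mem[OF feas(2) assms(3)] PiE_mem[OF feas(3) assms(3)]
    by auto
  show "l0 \<le> ?l" "0 < x i \<Longrightarrow> ?l = l0"
    using assms(2,3) unfolding ANE_def by auto
  show pos: "s i = 1 \<Longrightarrow> 0 < x i + y i"
    using conv nn by force
  have cong: "load G i ?l (x i) (y i) = ff_speed G i" if "s i = 1"
    using congested_latency_eq_iff[OF assms(1,3) nn pos[OF that], THEN iffD1, OF refl] that by simp
  have free: "load G i (ff_latency G i) (x i) (y i) \<le> ff_speed G i"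
  proof (cases "0 < x i + y i")
    case True
    then show ?thesis using cap le_max_flow_iff[OF assms(1,3) nn] by simp
  next
    case False
    then have "x i = 0" "y i = 0" using nn by auto
    then show ?thesis using valid_road(3)[OF assms(1,3)] by (simp add: load_def)
  qed
  show congl: "ff_latency G i < ?l" if "s i = 1"
  proof (rule ccontr)
    assume "\<not> ff_latency G i < ?l"
    then have "ff_speed G i \<le> load G i (ff_latency G i) (x i) (y i)"
      using cong[OF that] load_mono[OF assms(1,3) nn, of ?l "ff_latency G i"] by simp
    then have "has_max_flow G i (x i) (y i)"
      using free has_max_flow_iff[OF assms(1,3) nn pos[OF that]] by simp
    then show False using conv that by simp
  qed
  show "ff_latency G i \<le> ?l"
    using s congl by (auto simp: latency_def)
  show "load G i ?l (x i) (y i) \<le> ff_speed G i"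
    using s cong free by (auto simp: latency_def)
qed

text \<open>The equilibrium latency is not unique if no road carries human-driven flow. Enlarging it
  to the minimum latency lowers all delay ratios, hence weakens the altruism constraints.\<close>

lemma ANE_at_minimum_latency:
  assumes "valid_network G" "altruism_profile \<phi>" "0 \<le> ybar" "roads G \<noteq> {}"
    and "(x, y, s) \<in> ANE G xbar ybar l \<phi>"
  shows "(x, y, s) \<in> ANE G xbar ybar (MIN i\<in>roads G. latency G i (x i) (y i) (s i)) \<phi>"
proof -
  let ?lat = "\<lambda>i. latency G i (x i) (y i) (s i)"
  let ?m = "MIN i\<in>roads G. ?lat i"
  have fin: "finite (roads G)" by (simp add: roads_def)
  have le: "\<forall>i\<in>roads G. ?m \<le> ?lat i" using fin by simp
  have ge: "l \<le> ?m"
    using fin assms(4) ANE_road(4)[OF assms(1,5)] by simp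
  have l: "0 < l" using ANE_D(1)[OF assms(5)] .
  have hum: "?lat i = ?m" if "i \<in> roads G" "0 < x i" for i
    using ANE_road(5)[OF assms(1,5) that] le ge that by force
  have "\<phi> (k / ?m) * ybar \<le> (\<Sum>i | i \<in> roads G \<and> ?lat i \<le> k. y i)" if k: "0 \<le> k" for k
  proof -
    have "\<phi> (k / ?m) \<le> \<phi> (k / l)"
    proof (rule mono_onD[of "{0..}" \<phi>])
      show "mono_on {0..} \<phi>" using assms(2) by (simp add: altruism_profile_def)
      show "k / ?m \<le> k / l" using k ge l by (intro divide_left_mono) auto
    qed (use k l ge in auto)
    then show ?thesis
      using ANE_D(4)[OF assms(5) k] mult_right_mono[OF _ assms(3)] by (meson order_trans)
  qed
  then show ?thesis
    using assms(5) l ge le hum unfolding ANE_def by auto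
qed

lemma BANE_le:
  assumes "r \<in> BANE G xbar ybar \<phi>" "r' \<in> ANE G xbar ybar l0 \<phi>"
  shows "total_latency G r \<le> total_latency G r'"
proof -
  have "\<not> total_latency G r' < total_latency G r"
    using assms unfolding BANE_def is_arg_min_def by blast
  then show ?thesis by simp
qed

text \<open>Nobody travels faster than the equilibrium latency, so the existence of an equilibrium
  shows that no autonomous flow insists on doing so.\<close>

lemma altruism_below_one:
  assumes "valid_network G" "(x, y, s) \<in> ANE G xbar ybar l0 \<phi>" "0 \<le> \<kappa>" "\<kappa> < 1"
  shows "\<phi> \<kappa> * ybar \<le> 0"
proof -
  have l: "0 < l0" using ANE_D(1)[OF assms(2)] .
  have none: "{i. i \<in> roads G \<and> latency G i (x i) (y i) (s i) \<le> \<kappa> * l0} = {}"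
  proof -
    have "\<kappa> * l0 < 1 * l0" using l assms(4) by (intro mult_strict_right_mono) auto
    then show ?thesis using ANE_road(4)[OF assms(1,2)] by fastforce
  qed
  show ?thesis
    using ANE_D(4)[OF assms(2), of "\<kappa> * l0"] l assms(3) unfolding none by simp
qed

lemma ANE_cost_ge:
  assumes "valid_network G" "(x, y, s) \<in> ANE G xbar ybar l0 \<phi>"
  shows "(xbar + ybar) * l0 \<le> total_latency G (x, y, s)"
proof -
  have "(xbar + ybar) * l0 = (\<Sum>i\<in>roads G. (x i + y i) * l0)"
    using ANE_D(2,3)[OF assms(2)] by (simp add: sum_distrib_right[symmetric] sum.distrib)
  also have "\<dots> \<le> total_latency G (x, y, s)"
    using ANE_road(1,2,4)[OF assms]
    by (auto simp: total_latency_def intro!: sum_mono mult_left_mono)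
  finally show ?thesis .
qed

text \<open>Every routing of the equilibrium costs at least the demand times \<open>l0\<close>, whereas traffic that
  fits on the roads faster than \<open>l0\<close> admits an equilibrium in which everybody has a latency
  below \<open>l0\<close>.\<close>

lemma BANE_not_below:
  assumes "valid_network G" "altruism_profile \<phi>" "0 \<le> ybar" "0 < xbar + ybar"
    and "(x, y, s) \<in> BANE G xbar ybar \<phi>" "(x, y, s) \<in> ANE G xbar ybar l0 \<phi>"
    and lowroads: "\<And>j. j \<in> roads G \<Longrightarrow> ff_latency G j < l0 \<Longrightarrow>
      0 \<le> x' j \<and> 0 \<le> y' j \<and> load G j l0 (x' j) (y' j) \<le> ff_speed G j"
    and "(\<Sum>j | j \<in> roads G \<and> ff_latency G j < l0. x' j) = xbar"
    and "(\<Sum>j | j \<in> roads G \<and> ff_latency G j < l0. y' j) = ybar"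
  shows False
proof -
  have "\<exists>l r. r \<in> ANE G xbar ybar l \<phi> \<and> total_latency G r < (xbar + ybar) * l0"
  proof (rule cheaper_equilibrium[OF assms(1) lowroads assms(8,9,4,3)])
    show "\<phi> \<kappa> \<le> 1" if "0 \<le> \<kappa>" for \<kappa>
      using assms(2) that by (auto simp: altruism_profile_def)
    show "\<phi> \<kappa> * ybar \<le> 0" if "0 \<le> \<kappa>" "\<kappa> < 1" for \<kappa>
      using altruism_below_one[OF assms(1,6) that] .
  qed
  then obtain l r where "r \<in> ANE G xbar ybar l \<phi>" "total_latency G r < (xbar + ybar) * l0"
    by blast
  then show False
    using BANE_le[OF assms(5)] ANE_cost_ge[OF assms(1,6)] by fastforce
qed

text \<open>Let \<open>P\<close> be the roads with free-flow latency below \<open>l0\<close> and \<open>Q\<close> the others. If the flow on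
  \<open>Q\<close> did not suffice to fill \<open>P\<close> to its load limits at \<open>l0\<close>, then \<open>BANE_not_below\<close> would
  apply. So it suffices; the filled routing is an equilibrium, and its cost is at most the sum
  of the original flows weighted with \<open>max l0 (ff_latency G i)\<close>. These weights are lower bounds for the latencies of the original
  routing, so by optimality they agree with them wherever there is flow.\<close>

lemma BANE_latency:
  assumes "valid_network G" "altruism_profile \<phi>" "0 \<le> ybar" "0 < xbar + ybar"
    and B: "(x, y, s) \<in> BANE G xbar ybar \<phi>" and A: "(x, y, s) \<in> ANE G xbar ybar l0 \<phi>"
    and "i \<in> roads G"
  shows "latency G i (x i) (y i) (s i) = max l0 (ff_latency G i)"
    and "s i = (if ff_latency G i < l0 then 1 else 0)"
proof -
  let ?R = "roads G" and ?a = "ff_latency G"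
  let ?lat = "\<lambda>i. latency G i (x i) (y i) (s i)"
  define P where "P = {j \<in> ?R. ?a j < l0}"
  define Q where "Q = {j \<in> ?R. \<not> ?a j < l0}"
  have fin: "finite ?R" "finite P" "finite Q" by (auto simp: P_def Q_def roads_def)
  have PQ: "?R = P \<union> Q" "P \<inter> Q = {}" "P \<subseteq> ?R" "Q \<subseteq> ?R" by (auto simp: P_def Q_def)
  have split: "sum f ?R = sum f P + sum f Q" for f :: "nat \<Rightarrow> real"
    unfolding PQ(1) using fin PQ by (intro sum.union_disjoint) auto
  note nn = ANE_road(1,2)[OF assms(1) A] and lat = ANE_road(4,8)[OF assms(1) A]
  have load_le: "load G j t (x j) (y j) \<le> ff_speed G j" if "j \<in> ?R" "t \<le> ?lat j" for j t
    using load_mono[OF assms(1) that(1) nn[OF that(1)] that(2)] ANE_road(9)[OF assms(1) A that(1)]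
    by linarith
  have pool: "0 \<le> sum x Q" "0 \<le> sum y Q" using nn PQ by (auto intro!: sum_nonneg)
  obtain c x' y' where c: "0 \<le> c" "c \<le> 1"
    and le: "\<And>j. j \<in> P \<Longrightarrow>
      x j \<le> x' j \<and> y j \<le> y' j \<and> load G j l0 (x' j) (y' j) \<le> ff_speed G j"
    and sums: "sum x' P = sum x P + (1 - c) * sum x Q" "sum y' P = sum y P + (1 - c) * sum y Q"
    and dich: "(\<forall>j\<in>P. load G j l0 (x' j) (y' j) = ff_speed G j) \<or> c = 0"
  proof (rule fill_roads[OF assms(1) PQ(3), of l0 x y "sum x Q" "sum y Q"])
    fix j assume "j \<in> P"
    then show "?a j \<le> l0 \<and> load G j l0 (x j) (y j) \<le> ff_speed G j"
      using load_le[of j l0] lat by (auto simp: P_def)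
  qed (use pool in auto)
  have nn': "0 \<le> x' j" "0 \<le> y' j" if "j \<in> P" for j
    using le[OF that] nn[of j] that PQ(3) by force+
  have saturated: "\<forall>j\<in>P. load G j l0 (x' j) (y' j) = ff_speed G j"
  proof (rule ccontr)
    assume "\<not> ?thesis"
    then have c0: "c = 0" using dich by blast
    show False
    proof (rule BANE_not_below[OF assms(1-4) B A, of x' y'])
      fix j assume "j \<in> ?R" "?a j < l0"
      then have "j \<in> P" by (simp add: P_def)
      then show "0 \<le> x' j \<and> 0 \<le> y' j \<and> load G j l0 (x' j) (y' j) \<le> ff_speed G j"
        using le nn' by auto
    next
      show "(\<Sum>j | j \<in> ?R \<and> ?a j < l0. x' j) = xbar" "(\<Sum>j | j \<in> ?R \<and> ?a j < l0. y' j) = ybar"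
        using sums c0 split[of x] split[of y] ANE_D(2,3)[OF A] by (simp_all add: P_def)
    qed
  qed
  define x2 where "x2 j = (if j \<in> P then x' j else c * x j)" for j
  define y2 where "y2 j = (if j \<in> P then y' j else c * y j)" for j
  have onP: "x2 j = x' j" "y2 j = y' j" if "j \<in> P" for j using that by (auto simp: x2_def y2_def)
  have onQ: "x2 j = c * x j" "y2 j = c * y j" if "j \<in> Q" for j
    using that PQ(2) by (auto simp: x2_def y2_def)
  have sumP: "sum x2 P = sum x' P" "sum y2 P = sum y' P" by (simp_all add: onP)
  have sumQ: "sum x2 Q = c * sum x Q" "sum y2 Q = c * sum y Q"
    by (simp_all add: onQ sum_distrib_left)
  have lev: "levelled G l0 x2 y2"
    unfolding levelled_def
  proof
    fix j assume j: "j \<in> ?R"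
    show "0 \<le> x2 j \<and> 0 \<le> y2 j \<and>
      (if ?a j < l0 then load G j l0 (x2 j) (y2 j) = ff_speed G j
       else load G j (?a j) (x2 j) (y2 j) \<le> ff_speed G j \<and> (0 < x2 j \<longrightarrow> ?a j = l0))"
    proof (cases "j \<in> P")
      case True
      then show ?thesis using saturated nn' onP by (auto simp: P_def)
    next
      case False
      then have jQ: "j \<in> Q" "\<not> ?a j < l0" using j by (auto simp: P_def Q_def)
      have "load G j (?a j) (c * x j) (c * y j) = c * load G j (?a j) (x j) (y j)"
        by (simp add: load_def algebra_simps)
      also have "\<dots> \<le> c * ff_speed G j"
        using load_le[OF j lat(2)[OF j]] c by (simp add: mult_left_mono)
      also have "\<dots> \<le> 1 * ff_speed G j"
        using c valid_road(3)[OF assms(1) j] by (intro mult_right_mono) auto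
      finally have "load G j (?a j) (x2 j) (y2 j) \<le> ff_speed G j" using onQ[OF jQ(1)] by simp
      moreover have "?a j = l0" if "0 < x2 j"
      proof -
        have "0 < x j" using that nn(1)[OF j] onQ[OF jQ(1)] c by (auto simp: zero_less_mult_iff)
        then show ?thesis using ANE_road(5)[OF assms(1) A j] lat(2)[OF j] jQ(2) by simp
      qed
      ultimately show ?thesis using jQ onQ[OF jQ(1)] nn[OF j] c by simp
    qed
  qed
  have l0: "0 < l0" using ANE_D(1)[OF A] .
  have "level_routing G l0 x2 y2 \<in> ANE G xbar ybar l0 \<phi>"
  proof (rule level_routing_in_ANE[OF assms(1) lev l0])
    show "sum x2 ?R = xbar" "sum y2 ?R = ybar"
      using split[of x] split[of y] ANE_D(2,3)[OF A]
      by (simp_all add: split[of x2] split[of y2] sumP sumQ sums algebra_simps)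
  next
    fix l :: real assume "0 \<le> l" "l < l0"
    then show "\<phi> (l / l0) * ybar \<le> 0"
      using l0 by (intro altruism_below_one[OF assms(1) A]) auto
  next
    fix l :: real assume l: "l0 \<le> l"
    let ?Ql = "{j \<in> Q. ?a j \<le> l}"
    \<comment> \<open>The roads with delay at most \<open>l\<close> lose a part of the flow that \<open>Q\<close> loses altogether, and
      they contain \<open>P\<close>, which receives all of it.\<close>
    have "\<phi> (l / l0) * ybar \<le> (\<Sum>j | j \<in> ?R \<and> ?lat j \<le> l. y j)"
      using ANE_D(4)[OF A, of l] l l0 by simp
    also have "\<dots> \<le> sum y (P \<union> ?Ql)"
    proof (rule sum_mono2)
      show "{j. j \<in> ?R \<and> ?lat j \<le> l} \<subseteq> P \<union> ?Ql"
        using lat(2) unfolding PQ(1) by (fastforce intro: order_trans)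
    qed (use fin PQ(3,4) nn(2) in auto)
    also have "\<dots> = sum y P + sum y ?Ql"
      using fin PQ(2) by (intro sum.union_disjoint) auto
    also have "\<dots> = sum y P + (1 - c) * sum y ?Ql + c * sum y ?Ql"
      by (simp add: algebra_simps)
    also have "\<dots> \<le> sum y P + (1 - c) * sum y Q + c * sum y ?Ql"
      using c fin nn(2) PQ(4) by (intro add_mono mult_left_mono sum_mono2) auto
    also have "\<dots> = sum y2 P + sum y2 ?Ql"
      by (simp add: sumP sums onQ sum_distrib_left)
    also have "\<dots> = sum y2 (P \<union> ?Ql)"
      using fin PQ(2) by (intro sum.union_disjoint[symmetric]) auto
    also have "P \<union> ?Ql = {j. j \<in> ?R \<and> ?a j \<le> l}"
      using l by (auto simp: P_def Q_def)
    finally show "\<phi> (l / l0) * ybar \<le> (\<Sum>j | j \<in> ?R \<and> ?a j \<le> l. y2 j)" .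
  qed
  then have "total_latency G (x, y, s) \<le> total_latency G (level_routing G l0 x2 y2)"
    by (rule BANE_le[OF B])
  also have "\<dots> = (\<Sum>j\<in>P. (x2 j + y2 j) * l0) + (\<Sum>j\<in>Q. (x2 j + y2 j) * ?a j)"
    unfolding level_routing_total_latency[OF assms(1) lev] split
    by (intro arg_cong2[of _ _ _ _ "(+)"] sum.cong) (auto simp: P_def Q_def)
  also have "\<dots> = (sum x P + sum y P) * l0 +
      ((1 - c) * (sum x Q + sum y Q) * l0 + c * (\<Sum>j\<in>Q. (x j + y j) * ?a j))"
  proof -
    have "(\<Sum>j\<in>P. (x2 j + y2 j) * l0) = (sum x2 P + sum y2 P) * l0"
      by (simp add: sum_distrib_right[symmetric] sum.distrib)
    also have "\<dots> = (sum x P + sum y P) * l0 + (1 - c) * (sum x Q + sum y Q) * l0"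
      unfolding sumP sums by (simp add: algebra_simps)
    finally have 1: "(\<Sum>j\<in>P. (x2 j + y2 j) * l0) =
      (sum x P + sum y P) * l0 + (1 - c) * (sum x Q + sum y Q) * l0" .
    have 2: "(\<Sum>j\<in>Q. (x2 j + y2 j) * ?a j) = c * (\<Sum>j\<in>Q. (x j + y j) * ?a j)"
      unfolding sum_distrib_left by (intro sum.cong) (auto simp: onQ algebra_simps)
    show ?thesis unfolding 1 2 by simp
  qed
  also have "\<dots> \<le> (sum x P + sum y P) * l0 +
      ((1 - c) * (\<Sum>j\<in>Q. (x j + y j) * ?a j) + c * (\<Sum>j\<in>Q. (x j + y j) * ?a j))"
  proof -
    have "(sum x Q + sum y Q) * l0 = (\<Sum>j\<in>Q. (x j + y j) * l0)"
      by (simp add: sum_distrib_right[symmetric] sum.distrib)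
    also have "\<dots> \<le> (\<Sum>j\<in>Q. (x j + y j) * ?a j)"
      using nn by (intro sum_mono mult_left_mono) (auto simp: Q_def)
    finally show ?thesis using c by (simp add: mult.assoc mult_left_mono)
  qed
  also have "\<dots> = (\<Sum>j\<in>P. (x j + y j) * l0) + (\<Sum>j\<in>Q. (x j + y j) * ?a j)"
  proof -
    have "(1 - c) * S + c * S = S" for S by (simp add: algebra_simps)
    then show ?thesis by (simp add: sum_distrib_right[symmetric] sum.distrib)
  qed
  also have "\<dots> = (\<Sum>j\<in>?R. (x j + y j) * max l0 (?a j))"
    unfolding split by (intro arg_cong2[of _ _ _ _ "(+)"] sum.cong) (auto simp: P_def Q_def)
  finally have upper: "(\<Sum>j\<in>?R. (x j + y j) * ?lat j) \<le> (\<Sum>j\<in>?R. (x j + y j) * max l0 (?a j))"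
    by (simp add: total_latency_def)
  have gap: "0 \<le> (x j + y j) * (?lat j - max l0 (?a j))" if "j \<in> ?R" for j
    using nn[OF that] lat[OF that] by simp
  have zero: "(\<Sum>j\<in>?R. (x j + y j) * (?lat j - max l0 (?a j))) = 0"
  proof (rule antisym)
    show "(\<Sum>j\<in>?R. (x j + y j) * (?lat j - max l0 (?a j))) \<le> 0"
      using upper by (simp add: right_diff_distrib sum_subtractf)
  qed (use gap in \<open>auto intro!: sum_nonneg\<close>)
  have "(x i + y i) * (?lat i - max l0 (?a i)) = 0"
    by (rule sum_nonneg_0[OF fin(1) _ zero assms(7)]) (rule gap)
  then have tight: "?lat i = max l0 (?a i)" if "s i = 1"
    using ANE_road(6)[OF assms(1) A assms(7) that] by simp
  show state: "s i = (if ?a i < l0 then 1 else 0)"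
  proof (cases "s i = 1")
    case True
    then show ?thesis
      using tight ANE_road(7)[OF assms(1) A assms(7) True] by (auto simp: max_def split: if_splits)
  next
    case False
    then have "s i = 0" using ANE_road(3)[OF assms(1) A assms(7)] by simp
    then show ?thesis using lat(1)[OF assms(7)] by (simp add: latency_def)
  qed
  show "?lat i = max l0 (?a i)"
    using state tight by (cases "s i = 1") (auto simp: latency_def split: if_splits)
qed

text \<open>Otherwise some autonomous flow could move from road \<open>k\<close> to the faster road \<open>i\<close>. Both roads
  are in free-flow, so no latency changes: the cost decreases strictly, and no altruistic
  user is worse off.\<close>

lemma BANE_max_flow:
  assumes "valid_network G" "altruism_profile \<phi>" "0 \<le> ybar" "0 < xbar + ybar"
    and B: "(x, y, s) \<in> BANE G xbar ybar \<phi>" and A: "(x, y, s) \<in> ANE G xbar ybar l0 \<phi>"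
    and i: "i \<in> roads G" and k: "k \<in> roads G" and ik: "i < k"
    and il: "l0 < ff_latency G i" and used: "0 < x k + y k"
  shows "has_max_flow G i (x i) (y i)"
proof (rule ccontr)
  assume not_max: "\<not> ?thesis"
  let ?R = "roads G" and ?a = "ff_latency G"
  have fin: "finite ?R" by (simp add: roads_def)
  note nn = ANE_road(1,2)[OF assms(1) A]
  note lat = BANE_latency(1)[OF assms(1-4) B A] and state = BANE_latency(2)[OF assms(1-4) B A]
  have aik: "?a i < ?a k" using ff_latency_less_iff[OF assms(1) i k] ik by simp
  have x0: "x j = 0" if "j \<in> ?R" "l0 < ?a j" for j
    using ANE_road(5)[OF assms(1) A that(1)] lat[OF that(1)] nn(1)[OF that(1)] that(2) by force
  have lev: "levelled G l0 x y"
    unfolding levelled_def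
  proof
    fix j assume j: "j \<in> ?R"
    have "load G j (max l0 (?a j)) (x j) (y j) \<le> ff_speed G j"
      using ANE_road(9)[OF assms(1) A j] lat[OF j] by simp
    moreover have "load G j l0 (x j) (y j) = ff_speed G j" if "?a j < l0"
    proof -
      have "s j = 1" using state[OF j] that by simp
      then show ?thesis
        using congested_latency_eq_iff[OF assms(1) j nn[OF j], of l0]
          ANE_road(6)[OF assms(1) A j] lat[OF j] that by simp
    qed
    moreover have "?a j = l0" if "0 < x j" "\<not> ?a j < l0"
      using ANE_road(5)[OF assms(1) A j that(1)] lat[OF j] that(2) by simp
    ultimately show "0 \<le> x j \<and> 0 \<le> y j \<and>
      (if ?a j < l0 then load G j l0 (x j) (y j) = ff_speed G j
       else load G j (?a j) (x j) (y j) \<le> ff_speed G j \<and> (0 < x j \<longrightarrow> ?a j = l0))"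
      using nn[OF j] by (auto simp: max_def split: if_splits)
  qed
  have yk: "0 < y k" using used x0[OF k] aik il by simp
  let ?b = "slot G i (?a i) (aut_headway G i)"
  have b: "0 < ?b" using slot_pos(2)[OF assms(1) i] by simp
  have room: "?b * y i < ff_speed G i"
  proof -
    have "load G i (?a i) (x i) (y i) = ?b * y i" using x0[OF i il] by (simp add: load_def)
    moreover have "load G i (?a i) (x i) (y i) \<le> ff_speed G i"
      using lev i il unfolding levelled_def by (auto split: if_splits)
    moreover have "load G i (?a i) (x i) (y i) \<noteq> ff_speed G i"
    proof (cases "0 < x i + y i")
      case True
      then show ?thesis using has_max_flow_iff[OF assms(1) i nn[OF i]] not_max by simp
    next
      case False
      then have "x i = 0" "y i = 0" using nn[OF i] by auto
      then show ?thesis using valid_road(3)[OF assms(1) i] by (simp add: load_def)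
    qed
    ultimately show ?thesis by simp
  qed
  \<comment> \<open>As much flow as road \<open>k\<close> has and road \<open>i\<close> has room for.\<close>
  define e where "e = min (y k) ((ff_speed G i - ?b * y i) / ?b)"
  have e: "0 < e" "e \<le> y k" using yk room b by (auto simp: e_def)
  have "e * ?b \<le> ff_speed G i - ?b * y i"
    using b unfolding pos_le_divide_eq[OF b, symmetric] e_def by simp
  then have fits: "?b * (y i + e) \<le> ff_speed G i" by (simp add: algebra_simps)
  define y' where "y' j = y j + e * (if j = i then 1 else 0) - e * (if j = k then 1 else 0)" for j
  have y'i: "y' i = y i + e" and y'k: "y' k = y k - e" using ik by (auto simp: y'_def)
  have y'o: "y' j = y j" if "j \<noteq> i" "j \<noteq> k" for j using that by (simp add: y'_def)
  have lev': "levelled G l0 x y'"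
    unfolding levelled_def
  proof
    fix j assume j: "j \<in> ?R"
    have old: "0 \<le> x j \<and> 0 \<le> y j \<and>
      (if ?a j < l0 then load G j l0 (x j) (y j) = ff_speed G j
       else load G j (?a j) (x j) (y j) \<le> ff_speed G j \<and> (0 < x j \<longrightarrow> ?a j = l0))"
      using lev j by (simp add: levelled_def)
    consider "j = i" | "j = k" | "j \<noteq> i" "j \<noteq> k" by blast
    then show "0 \<le> x j \<and> 0 \<le> y' j \<and>
      (if ?a j < l0 then load G j l0 (x j) (y' j) = ff_speed G j
       else load G j (?a j) (x j) (y' j) \<le> ff_speed G j \<and> (0 < x j \<longrightarrow> ?a j = l0))"
    proof cases
      case 1
      then show ?thesis using fits il e x0[OF i il] nn[OF i] y'i by (simp add: load_def)
    next
      case 2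
      have "load G k (?a k) (x k) (y k - e) \<le> load G k (?a k) (x k) (y k)"
        using slot_pos(2)[OF assms(1) k, of "?a k"] e by (simp add: load_def)
      then show ?thesis using 2 old il aik e x0[OF k] y'k by (auto split: if_splits)
    next
      case 3
      then show ?thesis using old y'o by simp
    qed
  qed
  have sum_y': "sum y' S = sum y S + e * (if i \<in> S then 1 else 0) - e * (if k \<in> S then 1 else 0)"
    if "finite S" for S
    using that unfolding y'_def
    by (simp add: sum.distrib sum_subtractf sum_distrib_left[symmetric])
  have l0: "0 < l0" using ANE_D(1)[OF A] .
  have "level_routing G l0 x y' \<in> ANE G xbar ybar l0 \<phi>"
  proof (rule level_routing_in_ANE[OF assms(1) lev' l0])
    show "sum x ?R = xbar" "sum y' ?R = ybar"
      using ANE_D(2,3)[OF A] sum_y'[OF fin] i k by auto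
  next
    fix l :: real assume "0 \<le> l" "l < l0"
    then show "\<phi> (l / l0) * ybar \<le> 0"
      using l0 by (intro altruism_below_one[OF assms(1) A]) auto
  next
    fix l :: real assume l: "l0 \<le> l"
    let ?S = "{j. j \<in> ?R \<and> ?a j \<le> l}"
    have "\<phi> (l / l0) * ybar \<le> (\<Sum>j | j \<in> ?R \<and> latency G j (x j) (y j) (s j) \<le> l. y j)"
      using ANE_D(4)[OF A, of l] l l0 by simp
    also have "{j. j \<in> ?R \<and> latency G j (x j) (y j) (s j) \<le> l} = ?S"
      using lat l by auto
    also have "sum y ?S \<le> sum y' ?S"
      using sum_y'[of ?S] fin e i k aik by auto
    finally show "\<phi> (l / l0) * ybar \<le> sum y' ?S" .
  qed
  then have "total_latency G (x, y, s) \<le> total_latency G (level_routing G l0 x y')"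
    by (rule BANE_le[OF B])
  also have "\<dots> = (\<Sum>j\<in>?R. (x j + y' j) * max l0 (?a j))"
    by (rule level_routing_total_latency[OF assms(1) lev'])
  also have "\<dots> = (\<Sum>j\<in>?R. (x j + y j) * max l0 (?a j) +
      ((if j = i then e * max l0 (?a j) else 0) - (if j = k then e * max l0 (?a j) else 0)))"
    by (intro sum.cong) (auto simp: y'_def algebra_simps)
  also have "\<dots> = total_latency G (x, y, s) + e * ?a i - e * ?a k"
    using fin i k il aik lat by (simp add: total_latency_def sum.distrib sum_subtractf)
  also have "\<dots> < total_latency G (x, y, s)"
    using e aik by simp
  finally show False by simp
qed

theorem theorem2:
  fixes G :: network and xbar ybar :: real and \<phi> :: "real \<Rightarrow> real"
  assumes "valid_network G"
    and "altruism_profile \<phi>"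
    and "0 \<le> xbar" and "0 \<le> ybar" and "0 < xbar + ybar"
    and "BANE G xbar ybar \<phi> \<noteq> {}"
  shows "\<forall>(x, y, s) \<in> BANE G xbar ybar \<phi>.
    \<exists>l0 m_EQ m_ALL.
      (x, y, s) \<in> ANE G xbar ybar l0 \<phi> \<and>
      longest_equilibrium_road G l0 (x, y, s) m_EQ \<and>
      longest_used_road G (x, y, s) m_ALL \<and>
      m_EQ \<le> m_ALL \<and>
      (\<forall>i\<in>roads G. i < m_EQ \<longrightarrow> s i = 1) \<and>
      (\<forall>i\<in>roads G. m_EQ < i \<longrightarrow> s i = 0) \<and>
      (\<forall>i\<in>roads G. m_EQ < i \<and> i < m_ALL \<longrightarrow> has_max_flow G i (x i) (y i))"
proof (clarify)
  fix x y s assume B: "(x, y, s) \<in> BANE G xbar ybar \<phi>"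
  let ?R = "roads G" and ?a = "ff_latency G"
  let ?lat = "\<lambda>i. latency G i (x i) (y i) (s i)"
  have fin: "finite ?R" by (simp add: roads_def)
  obtain l where Al: "(x, y, s) \<in> ANE G xbar ybar l \<phi>"
    using B unfolding BANE_def is_arg_min_def by auto
  have total: "(\<Sum>i\<in>?R. x i + y i) = xbar + ybar"
    using ANE_D(2,3)[OF Al] by (simp add: sum.distrib)
  then have ne: "?R \<noteq> {}" using assms(5) by auto
  define l0 where "l0 = (MIN i\<in>?R. ?lat i)"
  have A: "(x, y, s) \<in> ANE G xbar ybar l0 \<phi>"
    unfolding l0_def by (rule ANE_at_minimum_latency[OF assms(1,2,4) ne Al])
  note lat = BANE_latency(1)[OF assms(1,2,4,5) B A]
    and state = BANE_latency(2)[OF assms(1,2,4,5) B A] and nn = ANE_road(1,2)[OF assms(1) A]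
  define E where "E = {i \<in> ?R. ?lat i = l0}"
  define U where "U = {i \<in> ?R. 0 < x i + y i}"
  have finEU: "finite E" "finite U" by (auto simp: E_def U_def roads_def)
  have "l0 \<in> ?lat ` ?R" unfolding l0_def using fin ne by (intro Min_in) auto
  then have "E \<noteq> {}" by (auto simp: E_def)
  have "U \<noteq> {}"
  proof
    assume "U = {}"
    then have "(\<Sum>i\<in>?R. x i + y i) \<le> 0" by (intro sum_nonpos) (auto simp: U_def not_less)
    then show False using total assms(5) by simp
  qed
  define m where "m = Max E"
  define M where "M = Max U"
  have m: "m \<in> E" and m_max: "\<And>i. i \<in> E \<Longrightarrow> i \<le> m"
    using finEU \<open>E \<noteq> {}\<close> by (auto simp: m_def)
  have M: "M \<in> U" and M_max: "\<And>i. i \<in> U \<Longrightarrow> i \<le> M"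
    using finEU \<open>U \<noteq> {}\<close> by (auto simp: M_def)
  have mR: "m \<in> ?R" and ml: "?a m \<le> l0" using m lat[of m] by (auto simp: E_def)
  have MR: "M \<in> ?R" using M by (auto simp: U_def)
  note leI = ff_latency_le_iff[OF assms(1)] and lessI = ff_latency_less_iff[OF assms(1)]
  have EQ: "longest_equilibrium_road G l0 (x, y, s) m"
    using m m_max lessI[OF mR]
    by (auto simp: longest_equilibrium_road_def is_arg_max_def E_def not_less leI)
  have ALL: "longest_used_road G (x, y, s) M"
  proof -
    have "\<not> ?a M < ?a j" if "j \<in> ?R" "0 < x j + y j" for j
      using M_max[of j] lessI[OF MR that(1)] that by (auto simp: U_def)
    then show ?thesis using M by (auto simp: longest_used_road_def is_arg_max_def U_def)
  qed
  have beyond: "l0 < ?a i" if "i \<in> ?R" "m < i" for i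
    using m_max[of i] lat[OF that(1)] that by (force simp: E_def max_def split: if_splits)
  have before: "?a i < l0" if "i \<in> ?R" "i < m" for i
    using lessI[OF that(1) mR] that(2) ml by simp
  have "m \<le> M"
  proof (rule ccontr)
    assume "\<not> m \<le> M"
    then have unused: "x i = 0 \<and> y i = 0" if "i \<in> ?R" "\<not> ?a i < l0" for i
      using M_max[of i] before[OF that(1)] nn[OF that(1)] that by (force simp: U_def)
    show False
    proof (rule BANE_not_below[OF assms(1,2,4,5) B A, of x y])
      fix j assume j: "j \<in> ?R" "?a j < l0"
      then show "0 \<le> x j \<and> 0 \<le> y j \<and> load G j l0 (x j) (y j) \<le> ff_speed G j"
        using nn[OF j(1)] ANE_road(9)[OF assms(1) A j(1)] lat[OF j(1)] by simp
    next
      have "(\<Sum>j | j \<in> ?R \<and> ?a j < l0. x j) = sum x ?R" "(\<Sum>j | j \<in> ?R \<and> ?a j < l0. y j) = sum y ?R"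
        using fin unused by (auto intro!: sum.mono_neutral_left)
      then show "(\<Sum>j | j \<in> ?R \<and> ?a j < l0. x j) = xbar" "(\<Sum>j | j \<in> ?R \<and> ?a j < l0. y j) = ybar"
        using ANE_D(2,3)[OF A] by simp_all
    qed
  qed
  moreover have "\<forall>i\<in>?R. i < m \<longrightarrow> s i = 1" using before state by simp
  moreover have "\<forall>i\<in>?R. m < i \<longrightarrow> s i = 0" using beyond state by fastforce
  moreover have "\<forall>i\<in>?R. m < i \<and> i < M \<longrightarrow> has_max_flow G i (x i) (y i)"
    using BANE_max_flow[OF assms(1,2,4,5) B A _ MR] beyond M by (auto simp: U_def)
  ultimately show "\<exists>l0 m_EQ m_ALL.
      (x, y, s) \<in> ANE G xbar ybar l0 \<phi> \<and>
      longest_equilibrium_road G l0 (x, y, s) m_EQ \<and>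
      longest_used_road G (x, y, s) m_ALL \<and>
      m_EQ \<le> m_ALL \<and>
      (\<forall>i\<in>roads G. i < m_EQ \<longrightarrow> s i = 1) \<and>
      (\<forall>i\<in>roads G. m_EQ < i \<longrightarrow> s i = 0) \<and>
      (\<forall>i\<in>roads G. m_EQ < i \<and> i < m_ALL \<longrightarrow> has_max_flow G i (x i) (y i))"
    using A EQ ALL by blast
qed

end
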